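(* For every $\alpha\in\mathbb{C}$ with $\mathfrak{Re}(\alpha)>0$, $$I_{0^+}^\alpha\log\Gamma(1)=\frac{1}{\Gamma(\alpha+1)}\sum_{n=1}^{\infty}(-1)^{n+1}\binom{\alpha}{n}\sum_{k=0}^{n-1}(-1)^k\binom{n}{k}\log D_k .$$
   Context: $\Gamma$ is Euler's gamma function. For $\mathfrak{Re}(\alpha)>0$ the left-sided Riemann-Liouville fractional integral of order $\alpha$ of $f$ on $[a,b]$ is $I_{a^+}^\alpha f(x)=\frac{1}{\Gamma(\alpha)}\int_a^x (x-t)^{\alpha-1}f(t)\,dt$ for $a<x\le b$. Here it is applied with $a=0$, $b=1$, $x=1$ and $f(t)=\log\Gamma(t)$ (real logarithm, $t\in(0,1]$), so $I_{0^+}^\alpha\log\Gamma(1)=\frac{1}{\Gamma(\alpha)}\int_0^1(1-t)^{\alpha-1}\log\Gamma(t)\,dt$. For positive real $y$ and complex $s$, $y^s=e^{s\log y}$. Generalized binomial coefficient: $\binom{\alpha}{n}=\frac{\alpha(\alpha-1)\cdots(\alpha-n+1)}{n!}$. Generalized Glaisher constants $D_k>0$, $k=0,1,2,\dots$, are defined by $$\log D_k=\lim_{n\to\infty}\Big(\sum_{m=1}^n m^k\log m-p(n,k)\Big),$$ $$p(n,k)=\frac{n^k\log n}{2}+\frac{n^{k+1}}{k+1}\Big(\log n-\frac{1}{k+1}\Big)+k!\sum_{m=1}^{k}\frac{n^{k-m}B_{m+1}}{(m+1)!(k-m)!}\Big(\log n+(1-\delta_{km})\sum_{l=1}^{m}\frac{1}{k-l+1}\Big),$$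 where $\delta_{km}$ is the Kronecker delta, empty sums are $0$, and $B_j$ are the Bernoulli numbers given by $\frac{t}{e^t-1}=\sum_{j\ge0}B_j\frac{t^j}{j!}$ for $|t|<2\pi$. *)

theory Defs
  imports "HOL-Complex_Analysis.Complex_Analysis"
begin

definition RL_integral :: "complex \<Rightarrow> real \<Rightarrow> (real \<Rightarrow> complex) \<Rightarrow> real \<Rightarrow> complex" where
  "RL_integral \<alpha> a f x =
     1 / Gamma \<alpha> * (LINT t:{a..x}|lborel. complex_of_real (x - t) powr (\<alpha> - 1) * f t)"

text \<open>
  The Bernoulli numbers are read off the quotient \<open>t / (e^t - 1)\<close> of formal power series;
  lemma \<open>bernoulli_num_sums\<close> confirms the expansion on the disc \<open>|t| < 2\<pi>\<close>.
\<close>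

definition bernoulli_num :: "nat \<Rightarrow> real" where
  "bernoulli_num j = fact j * fps_nth (fps_X / (fps_exp 1 - 1)) j"

lemma bernoulli_num_fps:
  "Abs_fps (\<lambda>j. complex_of_real (bernoulli_num j) / fact j) = fps_X / (fps_exp 1 - 1)"
proof -
  define g where "g = (fps_X / (fps_exp 1 - 1) :: real fps)"
  define F where "F = Abs_fps (\<lambda>j. complex_of_real (fps_nth g j))"
  have "fps_nth (fps_exp 1 - 1 :: real fps) 1 \<noteq> fps_nth 0 1"
    and "fps_nth (fps_exp 1 - 1 :: complex fps) 1 \<noteq> fps_nth 0 1"
    by simp_all
  hence ne: "(fps_exp 1 - 1 :: real fps) \<noteq> 0" "(fps_exp 1 - 1 :: complex fps) \<noteq> 0"
    by metis+
  have sub: "subdegree (fps_exp 1 - 1 :: real fps) = 1"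
    by (rule subdegreeI) auto
  have "(fps_exp 1 - 1 :: real fps) dvd fps_X"
    using ne(1) by (subst fps_dvd_iff) (simp_all only: sub, simp_all)
  hence g: "g * (fps_exp 1 - 1) = fps_X"
    unfolding g_def by simp
  have "F * (fps_exp 1 - 1) = fps_X"
  proof (rule fps_ext)
    fix n
    have "fps_nth (F * (fps_exp 1 - 1)) n = of_real (fps_nth (g * (fps_exp 1 - 1)) n)"
      by (auto simp: fps_mult_nth F_def intro!: sum.cong)
    thus "fps_nth (F * (fps_exp 1 - 1)) n = fps_nth fps_X n"
      by (simp add: g)
  qed
  hence "F = fps_X / (fps_exp 1 - 1)"
    using ne(2) by (metis nonzero_mult_div_cancel_right)
  thus ?thesis
    by (simp add: F_def g_def bernoulli_num_def)
qed

lemma bernoulli_num_sums: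
  fixes t :: complex
  assumes "norm t < 2 * pi"
  shows "(\<lambda>j. of_real (bernoulli_num j) * t ^ j / fact j) sums
           (if t = 0 then 1 else t / (exp t - 1))"
proof -
  define g where "g = (fps_exp 1 - 1 :: complex fps)"
  have sub: "subdegree g = 1"
    unfolding g_def by (rule subdegreeI) auto
  have [simp]: "fps_conv_radius g = \<infinity>"
  proof -
    have "min (fps_conv_radius (fps_exp 1 :: complex fps)) (fps_conv_radius (1 :: complex fps))
            \<le> fps_conv_radius g"
      unfolding g_def by (rule fps_conv_radius_diff)
    thus ?thesis by simp
  qed
  have eval_g: "eval_fps g z = exp z - 1" for z
    unfolding g_def by (subst eval_fps_diff) auto
  have nz: "eval_fps g z \<noteq> 0" if "z \<in> eball 0 (ereal (2 * pi))" "z \<noteq> 0" for z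
  proof
    assume "eval_fps g z = 0"
    hence "exp z = 1" by (simp add: eval_g)
    then obtain n :: int where n: "Re z = 0" "Im z = of_int (2 * n) * pi"
      by (auto simp: exp_eq_1)
    have "n \<noteq> 0" using n that by (auto simp: complex_eq_iff)
    hence "1 \<le> \<bar>real_of_int n\<bar>" by linarith
    hence "2 * pi * 1 \<le> 2 * pi * \<bar>real_of_int n\<bar>" by (intro mult_left_mono) auto
    also have "\<dots> = \<bar>Im z\<bar>" using n by (simp add: abs_mult)
    also have "\<dots> \<le> norm z" by (rule abs_Im_le_cmod)
    finally show False using that by simp
  qed
  have le: "subdegree g \<le> subdegree (fps_X :: complex fps)"
    by (simp add: sub)
  have c: "1 = fps_nth fps_X (subdegree g) / fps_nth g (subdegree g)"
    by (simp only: sub) (simp add: g_def)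
  have less: "ereal (norm t) < Min {ereal (2 * pi), fps_conv_radius (fps_X :: complex fps), fps_conv_radius g}"
    using assms by simp
  have radius: "Min {ereal (2 * pi), fps_conv_radius (fps_X :: complex fps), fps_conv_radius g}
                  \<le> fps_conv_radius (fps_X / g)"
    by (rule fps_conv_radius_divide[OF le _ _ _ nz]) auto
  have "eval_fps (fps_X / g) t = (if t = 0 then 1 else eval_fps fps_X t / eval_fps g t)"
    by (rule eval_fps_divide[OF le _ _ _ nz less c]) auto
  moreover have "(\<lambda>n. fps_nth (fps_X / g) n * t ^ n) sums eval_fps (fps_X / g) t"
  proof (rule sums_eval_fps)
    show "ereal (norm t) < fps_conv_radius (fps_X / g)" using less radius by (rule less_le_trans)
  qed
  moreover have "fps_nth (fps_X / g) n = of_real (bernoulli_num n) / fact n" for n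
    unfolding g_def bernoulli_num_fps[symmetric] by simp
  ultimately show ?thesis by (cases "t = 0") (simp_all add: eval_g)
qed

text \<open>
  Here \<open>glaisher_p n k\<close> is \<open>p(n,k)\<close>. In its inner sums \<open>l \<le> m \<le> k\<close>, so the subtraction
  of natural numbers in the exponent is never truncated.
\<close>

definition glaisher_p :: "nat \<Rightarrow> nat \<Rightarrow> real" where
  "glaisher_p n k =
     real n ^ k * ln (real n) / 2
     + real n ^ (k + 1) / real (k + 1) * (ln (real n) - 1 / real (k + 1))
     + fact k * (\<Sum>m = 1..k. real n ^ (k - m) * bernoulli_num (m + 1) / (fact (m + 1) * fact (k - m))
         * (ln (real n)
            + (1 - (if k = m then 1 else 0)) * (\<Sum>l = 1..m. 1 / (real k - real l + 1))))"

definition glaisher_D :: "nat \<Rightarrow> real" where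
  "glaisher_D k = exp (lim (\<lambda>n. (\<Sum>m = 1..n. real m ^ k * ln (real m)) - glaisher_p n k))"

definition glaisher_term :: "complex \<Rightarrow> nat \<Rightarrow> complex" where
  "glaisher_term \<alpha> n = (-1) ^ (n + 1) * (\<alpha> gchoose n)
     * of_real (\<Sum>k = 0..<n. (-1) ^ k * real (n choose k) * ln (glaisher_D k))"

end

theory Submission
  imports Defs
begin

text \<open>
  The integral is evaluated by expanding $(1-t)^{\alpha-1}$ into its binomial series and
  integrating term by term, so everything comes down to the moments of $\log\Gamma$ on the unit
  interval:
  \[ n \int_0^1 t^{n-1} \log\Gamma(t)\,dt = \sum_{k<n} (-1)^k \binom{n}{k} \log D_k . \]
  The factor $n$ is absorbed by $\alpha \binom{\alpha-1}{n-1} = n \binom{\alpha}{n}$.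

  Termwise integration is justified by dominated convergence with a single elementary majorant.
  Log-convexity of $\Gamma$ gives $0 \le \log\Gamma(t) \le (1-t)\,t^{-1/2}$ on $(0,1]$
  (lemma \<open>ln_Gamma_bounds_unit\<close>); the zero at $t = 1$ pays for the factor $1/(1-t)$ in the
  bound $K \sum_n t^n = K/(1-t)$ for the partial sums, which results from the boundedness of the
  coefficients $\binom{\alpha-1}{n}$ when $\Re\alpha > 0$. The same
  bound makes the original integrand integrable.

  For the moments (lemma \<open>has_integral_power_ln_Gamma\<close>), write
  $\log\Gamma(t) = \log\Gamma(t+N) - \sum_{m<N} \log(t+m)$. Log-convexity yields
  $\log\Gamma(t+N) = \log\Gamma(N) + t \log N + O(1/N)$ uniformly on $[0,1]$, and the integrals of
  $n t^{n-1} \log(t+m)$ are elementary. After summation by parts the $n$-th moment equals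
  \[ \sum_{k<n} (-1)^k \binom{n}{k} \sum_{m \le N} m^k \log m + P(N) + Q(N) \log N + o(1) \]
  with polynomials $P$, $Q$ and $P(0) = 0$. The normalising functions $p(N,k)$ in the definition of
  the constants $D_k$ are of the shape $P(N) + Q(N) \log N$ with $P(0) = 0$ too. Hence the
  difference between the moment and $\sum_{k<n} (-1)^k \binom{n}{k} \log D_k$ is the limit of a sequence
  of that shape, and such a limit can only be $0$ (lemma \<open>null_log_polynomial_limit\<close>). In this way no
  identity between the coefficients of the various polynomials has to be verified; all that is
  required is that the limits defining the $D_k$ exist (lemma \<open>glaisher_limit\<close>). That is an
  instance of Euler-Maclaurin summation, whose error term is controlled by Taylor's theorem and
  the recurrence for the Bernoulli numbers.
\<close>

section \<open>Euler-Maclaurin summation and the existence of the Glaisher constants\<close>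

text \<open>
  Coefficient comparison in $\frac{t}{e^t-1} \cdot (e^t - 1) = t$.
\<close>

lemma bernoulli_num_recurrence:
  "(\<Sum>j\<le>s. bernoulli_num j / (fact j * fact (Suc s - j))) = (if s = 0 then 1 else 0)"
proof -
  define g where "g = (fps_X / (fps_exp 1 - 1) :: real fps)"
  have sub: "subdegree (fps_exp 1 - 1 :: real fps) = 1"
    by (rule subdegreeI) auto
  have ne: "(fps_exp 1 - 1 :: real fps) \<noteq> 0"
    using sub by auto
  have "(fps_exp 1 - 1 :: real fps) dvd fps_X"
    using ne by (subst fps_dvd_iff) (simp_all only: sub, simp_all)
  hence "g * (fps_exp 1 - 1) = fps_X"
    unfolding g_def by simp
  hence "fps_nth fps_X (Suc s) = (\<Sum>j=0..Suc s. fps_nth g j * fps_nth (fps_exp 1 - 1) (Suc s - j))"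
    by (metis fps_mult_nth)
  also have "\<dots> = (\<Sum>j=0..s. fps_nth g j * fps_nth (fps_exp 1 - 1) (Suc s - j))"
    by simp
  also have "\<dots> = (\<Sum>j\<le>s. bernoulli_num j / (fact j * fact (Suc s - j)))"
    unfolding atLeast0AtMost
    by (intro sum.cong) (auto simp: bernoulli_num_def g_def)
  finally show ?thesis
    by (simp add: fps_X_def)
qed

lemma bernoulli_num_0: "bernoulli_num 0 = 1"
  using bernoulli_num_recurrence[of 0] by simp

lemma bernoulli_num_1: "bernoulli_num (Suc 0) = - (1/2)"
  using bernoulli_num_recurrence[of 1] by (simp add: bernoulli_num_0)

text \<open>
  With $D$ for differentiation, applying $\frac{D}{e^D-1}$ to an antiderivative \<open>diff 0\<close> of \<open>diff 1\<close>
  formally yields a function whose forward difference, the operator $e^D - 1$, is \<open>diff 1\<close>. If the two operator series are cut off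
  at the same total order, the Bernoulli recurrence makes all lower orders cancel, and only multiples
  of Lagrange remainders of order \<open>Suc K\<close> survive.
\<close>

lemma euler_maclaurin_step:
  fixes diff :: "nat \<Rightarrow> real \<Rightarrow> real"
  assumes deriv: "\<And>j t. j \<le> K \<Longrightarrow> x \<le> t \<Longrightarrow> t \<le> x + 1 \<Longrightarrow>
                    (diff j has_real_derivative diff (Suc j) t) (at t)"
    and bound: "\<And>t. x \<le> t \<Longrightarrow> t \<le> x + 1 \<Longrightarrow> \<bar>diff (Suc K) t\<bar> \<le> M"
    and K: "1 \<le> K"
  shows "\<bar>(\<Sum>j\<le>K. bernoulli_num j / fact j * (diff j (x + 1) - diff j x)) - diff 1 x\<bar>
           \<le> (\<Sum>j\<le>K. \<bar>bernoulli_num j\<bar> / (fact j * fact (Suc K - j))) * M"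
proof -
  define b where "b j = bernoulli_num j / fact j" for j
  have "\<exists>e. \<bar>e\<bar> \<le> M \<and> diff j (x + 1) - diff j x
          = (\<Sum>s=Suc j..K. diff s x / fact (s - j)) + e / fact (Suc K - j)" if j: "j \<le> K" for j
  proof -
    have "\<exists>t>x. t < x + 1 \<and> diff j (x + 1) = (\<Sum>m<Suc K - j. diff (j + m) x / fact m * (x + 1 - x) ^ m)
            + diff (j + (Suc K - j)) t / fact (Suc K - j) * (x + 1 - x) ^ (Suc K - j)"
      using j by (intro Taylor_up[where a = x and diff = "\<lambda>m. diff (j + m)"]) (auto intro!: deriv)
    then obtain t where t: "x < t" "t < x + 1"
      and eq: "diff j (x + 1) = (\<Sum>m<Suc K - j. diff (j + m) x / fact m) + diff (Suc K) t / fact (Suc K - j)"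
      using j by auto
    have "(\<Sum>m<Suc K - j. diff (j + m) x / fact m) = (\<Sum>s=j..K. diff s x / fact (s - j))"
      using j by (intro sum.reindex_bij_witness[of _ "\<lambda>s. s - j" "\<lambda>m. j + m"]) auto
    also have "\<dots> = diff j x + (\<Sum>s=Suc j..K. diff s x / fact (s - j))"
      using j by (subst sum.atLeast_Suc_atMost) auto
    finally show ?thesis
      using eq bound[of t] t by (intro exI[of _ "diff (Suc K) t"]) auto
  qed
  then obtain e where e: "\<And>j. j \<le> K \<Longrightarrow> \<bar>e j\<bar> \<le> M"
    and eq: "\<And>j. j \<le> K \<Longrightarrow> diff j (x + 1) - diff j x
          = (\<Sum>s=Suc j..K. diff s x / fact (s - j)) + e j / fact (Suc K - j)"
    by metis
  \<comment> \<open>Collecting the Taylor coefficients by the order \<open>s\<close> of the derivative exposes the recurrence.\<close>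
  have "(\<Sum>j\<le>K. \<Sum>s=Suc j..K. b j * (diff s x / fact (s - j)))
          = (\<Sum>s\<le>K. \<Sum>j<s. b j * (diff s x / fact (s - j)))"
    unfolding sum.nested_swap' by (simp flip: lessThan_Suc_atMost)
  also have "\<dots> = (\<Sum>s\<le>K. if s = 1 then diff 1 x else 0)"
  proof (intro sum.cong refl)
    fix s
    show "(\<Sum>j<s. b j * (diff s x / fact (s - j))) = (if s = 1 then diff 1 x else 0)"
    proof (cases s)
      case (Suc r)
      have "(\<Sum>j<s. b j * (diff s x / fact (s - j)))
              = diff s x * (\<Sum>j\<le>r. bernoulli_num j / (fact j * fact (Suc r - j)))"
        unfolding Suc lessThan_Suc_atMost b_def by (simp add: sum_distrib_left mult_ac)
      thus ?thesis
        unfolding bernoulli_num_recurrence using Suc by simp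
    qed simp
  qed
  also have "\<dots> = diff 1 x"
    using K by simp
  finally have main: "(\<Sum>j\<le>K. \<Sum>s=Suc j..K. b j * (diff s x / fact (s - j))) = diff 1 x" .
  have "(\<Sum>j\<le>K. b j * (diff j (x + 1) - diff j x)) - diff 1 x = (\<Sum>j\<le>K. b j * (e j / fact (Suc K - j)))"
    unfolding main[symmetric] using eq by (simp add: sum.distrib sum_distrib_left distrib_left)
  also have "\<bar>\<dots>\<bar> \<le> (\<Sum>j\<le>K. \<bar>bernoulli_num j\<bar> / (fact j * fact (Suc K - j)) * M)"
  proof (intro order.trans[OF sum_abs] sum_mono)
    fix j assume "j \<in> {..K}"
    hence "\<bar>e j\<bar> \<le> M" using e by auto
    hence "\<bar>bernoulli_num j\<bar> / (fact j * fact (Suc K - j)) * \<bar>e j\<bar>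
             \<le> \<bar>bernoulli_num j\<bar> / (fact j * fact (Suc K - j)) * M"
      by (intro mult_left_mono) auto
    thus "\<bar>b j * (e j / fact (Suc K - j))\<bar> \<le> \<bar>bernoulli_num j\<bar> / (fact j * fact (Suc K - j)) * M"
      by (simp add: b_def abs_mult)
  qed
  finally show ?thesis
    by (simp add: b_def sum_distrib_right)
qed

text \<open>
  The sequence \<open>powlog_deriv k\<close> starts with the antiderivative
  $\frac{x^{k+1}}{k+1}(\log x - \frac{1}{k+1})$ of $x^k \log x$ and continues with its successive
  derivatives, up to order $k+3$. As long as a power of $x$ remains, the derivative of order $j$ is
  a multiple of $x^{k+1-j} (\log x + c_j)$, and \<open>powlog_const k j\<close> is this $c_j$.
\<close>

definition powlog_const :: "nat \<Rightarrow> nat \<Rightarrow> real" where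
  "powlog_const k j = (\<Sum>i<j. 1 / (real k + 1 - real i)) - 1 / (real k + 1)"

definition powlog_deriv :: "nat \<Rightarrow> nat \<Rightarrow> real \<Rightarrow> real" where
  "powlog_deriv k j x =
     (if j \<le> Suc k then fact k / fact (Suc k - j) * x ^ (Suc k - j) * (ln x + powlog_const k j)
      else if j = Suc (Suc k) then fact k / x
      else - (fact k / x ^ 2))"

lemma DERIV_powlog_deriv:
  assumes "x > 0" "j \<le> Suc (Suc k)"
  shows "(powlog_deriv k j has_real_derivative powlog_deriv k (Suc j) x) (at x)"
proof -
  consider "j \<le> k" | "j = Suc k" | "j = Suc (Suc k)"
    using assms by linarith
  thus ?thesis
  proof cases
    case 1
    then obtain d where k: "k = j + d"
      using le_Suc_ex by blast
    have fact_Suc': "fact (Suc d) = (real d + 1) * fact d"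
      by (simp add: algebra_simps)
    have const: "powlog_const k (Suc j) = powlog_const k j + 1 / (real d + 1)"
      by (simp add: powlog_const_def k)
    have "((\<lambda>x. fact k / fact (Suc d) * x ^ Suc d * (ln x + powlog_const k j)) has_real_derivative
             fact k / fact d * x ^ d * (ln x + powlog_const k (Suc j))) (at x)"
    proof (rule DERIV_cong)
      show "((\<lambda>x. fact k / fact (Suc d) * x ^ Suc d * (ln x + powlog_const k j)) has_real_derivative
              fact k / fact (Suc d) * x ^ Suc d * (1 / x)
                + fact k / fact (Suc d) * (real (Suc d) * x ^ d) * (ln x + powlog_const k j)) (at x)"
        using assms(1) by (auto intro!: derivative_eq_intros simp: add_divide_distrib distrib_left mult_ac simp del: fact_Suc power_Suc of_nat_Suc)
    next
      have "fact k / fact (Suc d) * x ^ Suc d * (1 / x) = fact k / fact d * x ^ d * (1 / (real d + 1))"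
        using assms(1) unfolding fact_Suc' by simp
      moreover have "fact k / fact (Suc d) * (real (Suc d) * x ^ d) = fact k / fact d * x ^ d"
        by (simp add: fact_Suc' add.commute)
      ultimately show "fact k / fact (Suc d) * x ^ Suc d * (1 / x)
                + fact k / fact (Suc d) * (real (Suc d) * x ^ d) * (ln x + powlog_const k j)
             = fact k / fact d * x ^ d * (ln x + powlog_const k (Suc j))"
        unfolding const by (simp only: distrib_left add_ac)
    qed
    thus ?thesis
      by (simp add: powlog_deriv_def[abs_def] k Suc_diff_le)
  next
    case 2
    have "((\<lambda>x. fact k * (ln x + powlog_const k j)) has_real_derivative fact k / x) (at x)"
      using assms by (auto intro!: derivative_eq_intros)
    thus ?thesis
      by (simp add: powlog_deriv_def[abs_def] 2)
  next
    case 3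
    have "((\<lambda>x. fact k / x) has_real_derivative - (fact k / x ^ 2)) (at x)"
      using assms by (auto intro!: derivative_eq_intros simp: power2_eq_square)
    thus ?thesis
      by (simp add: powlog_deriv_def[abs_def] 3)
  qed
qed

lemma powlog_deriv_1: "powlog_deriv k 1 x = x ^ k * ln x"
  by (simp add: powlog_deriv_def powlog_const_def add.commute)

text \<open>
  Consecutive terms differ by $O(n^{-2})$, the size of \<open>powlog_deriv k (k + 3)\<close>. The expansion goes
  one order beyond the logarithmic terms because stopping earlier would bound the remainder only by
  $O(n^{-1})$, which is not summable.
\<close>

lemma powlog_sum_minus_euler_maclaurin_convergent:
  "convergent (\<lambda>n. (\<Sum>m=1..<n. real m ^ k * ln (real m))
      - (\<Sum>j\<le>Suc (Suc k). bernoulli_num j / fact j * powlog_deriv k j (real n)))"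
proof -
  define a where "a n = (\<Sum>m=1..<n. real m ^ k * ln (real m))
      - (\<Sum>j\<le>Suc (Suc k). bernoulli_num j / fact j * powlog_deriv k j (real n))" for n
  define C where "C = (\<Sum>j\<le>Suc (Suc k). \<bar>bernoulli_num j\<bar> / (fact j * fact (Suc (Suc (Suc k)) - j)))"
  have step: "norm (a (Suc n) - a n) \<le> C * fact k * inverse (real n ^ 2)" if "n \<ge> 1" for n
  proof -
    have "\<bar>(\<Sum>j\<le>Suc (Suc k). bernoulli_num j / fact j * (powlog_deriv k j (real n + 1) - powlog_deriv k j (real n)))
             - powlog_deriv k 1 (real n)\<bar> \<le> C * (fact k / real n ^ 2)"
      unfolding C_def
    proof (rule euler_maclaurin_step)
      fix t assume t: "real n \<le> t"
      have "fact k / t ^ 2 \<le> fact k / real n ^ 2"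
        using t that by (intro divide_left_mono power_mono mult_pos_pos) auto
      thus "\<bar>powlog_deriv k (Suc (Suc (Suc k))) t\<bar> \<le> fact k / real n ^ 2"
        by (simp add: powlog_deriv_def)
    qed (use that in \<open>auto intro!: DERIV_powlog_deriv\<close>)
    moreover have "a (Suc n) - a n = powlog_deriv k 1 (real n) -
        (\<Sum>j\<le>Suc (Suc k). bernoulli_num j / fact j * (powlog_deriv k j (real n + 1) - powlog_deriv k j (real n)))"
      using that unfolding a_def powlog_deriv_1 right_diff_distrib sum_subtractf
      by (simp add: add.commute del: sum.atMost_Suc)
    ultimately show ?thesis
      by (simp only: real_norm_def abs_minus_commute divide_inverse mult.assoc)
  qed
  have "summable (\<lambda>n. C * fact k * inverse (real n ^ 2))"
    by (intro summable_mult inverse_power_summable) auto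
  hence "summable (\<lambda>n. a (Suc n) - a n)"
    using step by (rule summable_comparison_test'[of _ 1])
  hence "convergent (\<lambda>n. \<Sum>i<n. a (Suc i) - a i)"
    by (simp add: summable_iff_convergent)
  hence "convergent (\<lambda>n. a n - a 0)"
    unfolding sum_lessThan_telescope .
  thus ?thesis
    by (simp only: convergent_diff_const_right_iff a_def)
qed

text \<open>
  So $p(n,k)$ is the Euler-Maclaurin expansion of $\sum_{m \le n} m^k \log m$ up to its
  last logarithmic term and without its constant term, the effect of the Kronecker delta. The
  Bernoulli sum belongs to the sum over $m < n$; adding $m = n$ turns $B_1 = -\frac12$ into the $+\frac12$ in front of $n^k \log n$.
\<close>

lemma glaisher_p_eq_powlog_deriv:
  "glaisher_p n k = real n ^ k * ln (real n)
     + (\<Sum>j\<le>Suc k. bernoulli_num j / fact j * powlog_deriv k j (real n))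
     - bernoulli_num (Suc k) / real (Suc k) * powlog_const k (Suc k)"
proof -
  let ?b = "\<lambda>j. bernoulli_num j / fact j * powlog_deriv k j (real n)"
  let ?c = "bernoulli_num (Suc k) / real (Suc k) * powlog_const k (Suc k)"
  have const: "(\<Sum>l=1..m. 1 / (real k - real l + 1)) = powlog_const k (Suc m)" for m
  proof -
    have "powlog_const k (Suc m) = (\<Sum>i<m. 1 / (real k - real i))"
      unfolding powlog_const_def by (subst sum.lessThan_Suc_shift) simp
    also have "\<dots> = (\<Sum>l=1..m. 1 / (real k - real l + 1))"
      by (intro sum.reindex_bij_witness[of _ "\<lambda>l. l - 1" Suc]) auto
    finally show ?thesis ..
  qed
  have F: "real n ^ (k + 1) / real (k + 1) * (ln (real n) - 1 / real (k + 1)) = ?b 0"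
  proof -
    have "fact k / fact (Suc k) = 1 / real (k + 1)"
      by simp
    thus ?thesis
      by (simp add: powlog_deriv_def powlog_const_def bernoulli_num_0 add.commute del: fact_Suc)
  qed
  have f: "real n ^ k * ln (real n) / 2 = real n ^ k * ln (real n) + ?b (Suc 0)"
    using powlog_deriv_1[of k n] by (simp add: bernoulli_num_1)
  have rest: "fact k * (\<Sum>m = 1..k. real n ^ (k - m) * bernoulli_num (m + 1) / (fact (m + 1) * fact (k - m))
         * (ln (real n) + (1 - (if k = m then 1 else 0)) * (\<Sum>l = 1..m. 1 / (real k - real l + 1))))
     = (\<Sum>m=1..k. ?b (Suc m)) - ?c"
  proof -
    have "fact k * (\<Sum>m = 1..k. real n ^ (k - m) * bernoulli_num (m + 1) / (fact (m + 1) * fact (k - m))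
         * (ln (real n) + (1 - (if k = m then 1 else 0)) * (\<Sum>l = 1..m. 1 / (real k - real l + 1))))
       = (\<Sum>m=1..k. ?b (Suc m) - (if m = k then ?c else 0))"
    proof (subst sum_distrib_left, intro sum.cong refl)
      fix m assume m: "m \<in> {1..k}"
      show "fact k * (real n ^ (k - m) * bernoulli_num (m + 1) / (fact (m + 1) * fact (k - m))
         * (ln (real n) + (1 - (if k = m then 1 else 0)) * (\<Sum>l = 1..m. 1 / (real k - real l + 1))))
        = ?b (Suc m) - (if m = k then ?c else 0)"
      proof (cases "m = k")
        case True
        have "fact (Suc k) = real (Suc k) * fact k" by simp
        thus ?thesis
          unfolding const by (simp add: True powlog_deriv_def field_simps del: fact_Suc of_nat_Suc)
      next
        case False
        thus ?thesis
          using m unfolding const by (simp add: powlog_deriv_def del: fact_Suc)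
      qed
    qed
    also have "\<dots> = (\<Sum>m=1..k. ?b (Suc m)) - (if k \<ge> 1 then ?c else 0)"
      by (simp add: sum_subtractf)
    also have "(if k \<ge> 1 then ?c else 0) = ?c"
      by (cases k) (auto simp: powlog_const_def)
    finally show ?thesis .
  qed
  have "(\<Sum>j\<le>Suc k. ?b j) = ?b 0 + ?b (Suc 0) + (\<Sum>m=1..k. ?b (Suc m))"
    unfolding sum.atMost_Suc_shift atMost_atLeast0[of k]
    by (subst sum.atLeast_Suc_atMost) auto
  thus ?thesis
    unfolding glaisher_p_def F f rest by simp
qed

lemma glaisher_limit:
  "(\<lambda>n. (\<Sum>m=1..n. real m ^ k * ln (real m)) - glaisher_p n k) \<longlonglongrightarrow> ln (glaisher_D k)"
proof -
  let ?b = "\<lambda>j n. bernoulli_num j / fact j * powlog_deriv k j (real n)"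
  let ?c = "bernoulli_num (Suc k) / real (Suc k) * powlog_const k (Suc k)"
  let ?a = "\<lambda>n. (\<Sum>m=1..<n. real m ^ k * ln (real m)) - (\<Sum>j\<le>Suc (Suc k). ?b j n)"
  have "(\<lambda>n. fact k / real n) \<longlonglongrightarrow> 0"
    by (intro real_tendsto_divide_at_top[OF tendsto_const] filterlim_real_sequentially)
  hence "(\<lambda>n. bernoulli_num (Suc (Suc k)) / fact (Suc (Suc k)) * (fact k / real n)) \<longlonglongrightarrow> 0"
    by (rule tendsto_mult_right_zero)
  hence "convergent (\<lambda>n. ?b (Suc (Suc k)) n)"
    by (simp add: powlog_deriv_def del: fact_Suc) (auto simp: convergent_def)
  hence "convergent (\<lambda>n. ?a n + ?b (Suc (Suc k)) n + ?c)"
    by (intro convergent_add powlog_sum_minus_euler_maclaurin_convergent convergent_const)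
  also have "(\<lambda>n. ?a n + ?b (Suc (Suc k)) n + ?c)
               = (\<lambda>n. (\<Sum>m=1..n. real m ^ k * ln (real m)) - glaisher_p n k)"
  proof
    fix n
    have "(\<Sum>m=1..n. real m ^ k * ln (real m)) = (\<Sum>m=1..<n. real m ^ k * ln (real m)) + real n ^ k * ln (real n)"
      by (cases "n = 0") (simp_all add: sum.last_plus)
    thus "?a n + ?b (Suc (Suc k)) n + ?c = (\<Sum>m=1..n. real m ^ k * ln (real m)) - glaisher_p n k"
      unfolding glaisher_p_eq_powlog_deriv sum.atMost_Suc[of _ "Suc k"] by linarith
  qed
  finally show ?thesis
    unfolding glaisher_D_def ln_exp by (simp add: convergent_LIMSEQ_iff)
qed

section \<open>Bounds for the logarithm of the Gamma function\<close>

lemma ln_Gamma_plus_1: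
  fixes x :: real
  assumes "x > 0"
  shows "ln (Gamma (x + 1)) = ln (Gamma x) + ln x"
proof -
  have "Gamma (x + 1) = x * Gamma x"
    using assms by (intro Gamma_plus1) (auto elim: nonpos_Ints_cases)
  moreover have "Gamma x \<noteq> 0"
    using Gamma_real_pos[OF assms] by linarith
  ultimately show ?thesis
    using assms by (simp add: ln_mult)
qed

lemma ln_Gamma_plus_nat:
  fixes x :: real
  assumes "x > 0"
  shows "ln (Gamma (x + real N)) = ln (Gamma x) + (\<Sum>m<N. ln (x + real m))"
proof (induction N)
  case (Suc N)
  thus ?case
    using ln_Gamma_plus_1[of "x + real N"] assms by (simp add: add_ac)
qed simp

text \<open>
  Log-convexity between $x$ and $x + 1$.
\<close>

lemma ln_Gamma_add_le:
  fixes x t :: real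
  assumes "x > 0" "0 \<le> t" "t \<le> 1"
  shows "ln (Gamma (x + t)) \<le> ln (Gamma x) + t * ln x"
proof -
  have "(ln \<circ> Gamma) ((1 - t) *\<^sub>R x + t *\<^sub>R (x + 1)) \<le> (1 - t) * (ln \<circ> Gamma) x + t * (ln \<circ> Gamma) (x + 1)"
    using assms by (intro convex_onD[OF log_convex_Gamma_real]) auto
  also have "(1 - t) *\<^sub>R x + t *\<^sub>R (x + 1) = x + t"
    by (simp add: algebra_simps)
  finally show ?thesis
    unfolding o_def ln_Gamma_plus_1[OF assms(1)] by (simp add: algebra_simps)
qed

text \<open>
  The upper bound, applied with base point $x + t$ and step $1 - t$, bounds $\log\Gamma(x+1)$ and hence
  $\log\Gamma(x+t)$ from below; replacing $\log(x+t)$ by $\log x$ costs at most $1/x$.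
\<close>

lemma ln_Gamma_add_ge:
  fixes x t :: real
  assumes x: "x > 0" and t: "0 \<le> t" "t \<le> 1"
  shows "ln (Gamma (x + t)) \<ge> ln (Gamma x) + t * ln x - 1 / x"
proof -
  have "ln (Gamma (x + t + (1 - t))) \<le> ln (Gamma (x + t)) + (1 - t) * ln (x + t)"
    using assms by (intro ln_Gamma_add_le) auto
  hence *: "ln (Gamma x) + ln x \<le> ln (Gamma (x + t)) + (1 - t) * ln (x + t)"
    using ln_Gamma_plus_1[OF x] by simp
  have "ln (x + t) - ln x \<le> (x + t - x) / x"
    using assms by (intro ln_diff_le) auto
  also have "\<dots> \<le> 1 / x"
    using assms by (simp add: divide_right_mono)
  finally have "(1 - t) * (ln (x + t) - ln x) \<le> (1 - t) * (1 / x)"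
    using t by (intro mult_left_mono) auto
  also have "\<dots> \<le> 1 / x"
    using assms by (intro mult_left_le_one_le) auto
  finally show ?thesis
    using * by (simp add: algebra_simps)
qed

text \<open>
  With $u = \sqrt t$ this says $1/u - u + 2 \log u \ge 0$ for $0 < u \le 1$; the left-hand side vanishes at
  $u = 1$ and has derivative $-(1 - 1/u)^2$.
\<close>

lemma minus_ln_le:
  fixes t :: real
  assumes "0 < t" "t \<le> 1"
  shows "- ln t \<le> (1 - t) * t powr (-1/2)"
proof -
  have deriv: "((\<lambda>u. 1 / u - u + 2 * ln u) has_real_derivative - ((1 - 1 / u) ^ 2)) (at u)" if "u > 0" for u :: real
    using that by (auto intro!: derivative_eq_intros simp: field_simps power2_eq_square)
  have "1 / 1 - 1 + 2 * ln 1 \<le> 1 / sqrt t - sqrt t + 2 * ln (sqrt t)"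
  proof (rule DERIV_nonpos_imp_nonincreasing[where f = "\<lambda>u. 1 / u - u + 2 * ln u"])
    fix u assume "sqrt t \<le> u"
    hence "u > 0" using assms(1) by (meson less_le_trans real_sqrt_gt_zero)
    thus "\<exists>y. ((\<lambda>u. 1 / u - u + 2 * ln u) has_real_derivative y) (at u) \<and> y \<le> 0"
      using deriv by (intro exI[of _ "- ((1 - 1 / u) ^ 2)"]) auto
  qed (use assms in auto)
  moreover have "(1 - t) * t powr (-1/2) = 1 / sqrt t - sqrt t"
    using assms by (simp add: powr_minus powr_half_sqrt divide_simps)
  ultimately show ?thesis
    using assms by (simp add: ln_sqrt)
qed

text \<open>
  The lower bound is log-convexity between $t$ and $t + 1$, evaluated at $1$; the upper bound combines
  $\Gamma(1+t) \le 1$ with lemma \<open>minus_ln_le\<close>. The factor $1 - t$ is what makes a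
  weight of size $1/(1-t)$ integrable against $\log\Gamma$.
\<close>

lemma ln_Gamma_bounds_unit:
  fixes t :: real
  assumes "0 < t" "t \<le> 1"
  shows "0 \<le> ln (Gamma t)" "ln (Gamma t) \<le> (1 - t) * t powr (-1/2)"
proof -
  have "ln (Gamma (t + (1 - t))) \<le> ln (Gamma t) + (1 - t) * ln t"
    using assms by (intro ln_Gamma_add_le) auto
  moreover have "(1 - t) * ln t \<le> 0"
    using assms by (intro mult_nonneg_nonpos) auto
  ultimately show "0 \<le> ln (Gamma t)"
    by simp
  have "ln (Gamma (1 + t)) \<le> ln (Gamma 1) + t * ln 1"
    using assms by (intro ln_Gamma_add_le) auto
  hence "ln (Gamma t) \<le> - ln t"
    using ln_Gamma_plus_1[OF assms(1)] by (simp add: add.commute)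
  thus "ln (Gamma t) \<le> (1 - t) * t powr (-1/2)"
    using minus_ln_le[OF assms] by linarith
qed

lemma set_integrable_powr_minus_half: "set_integrable lborel {0..1} (\<lambda>t::real. t powr (-1/2))"
proof -
  have "(\<lambda>t::real. t powr (-1/2)) absolutely_integrable_on {0..1}"
    by (intro nonnegative_absolutely_integrable_1 integrable_on_powr_from_0) auto
  thus ?thesis
    unfolding set_integrable_def by (subst (asm) integrable_completion) auto
qed

text \<open>
  Continuity of the weight inside the open interval suffices, since \<open>ln (Gamma t)\<close> vanishes at both
  endpoints: at $1$ because $\Gamma(1) = 1$, at $0$ by the conventions \<open>Gamma 0 = 0\<close> and \<open>ln 0 = 0\<close>.
\<close>

lemma measurable_weighted_ln_Gamma:
  fixes w :: "real \<Rightarrow> 'a :: {banach, second_countable_topology}"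
  assumes "continuous_on {0<..<1} w"
  shows "(\<lambda>t. indicator {0..1} t *\<^sub>R (ln (Gamma t) *\<^sub>R w t)) \<in> borel_measurable borel"
proof -
  have "(\<lambda>t. indicator {0<..<1} t *\<^sub>R (ln (Gamma t) *\<^sub>R w t)) \<in> borel_measurable borel"
  proof (intro borel_measurable_continuous_on_indicator continuous_on_scaleR continuous_on_ln assms)
    show "continuous_on {0<..<1} (Gamma :: real \<Rightarrow> real)"
      by (intro continuous_on_Gamma) (auto elim!: nonpos_Ints_cases)
    show "\<forall>t\<in>{0<..<1}. Gamma (t :: real) \<noteq> 0"
      using Gamma_real_pos by (metis greaterThanLessThan_iff less_irrefl)
  qed auto
  also have "(\<lambda>t. indicator {0<..<1} t *\<^sub>R (ln (Gamma t) *\<^sub>R w t))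
               = (\<lambda>t. indicator {0..1} t *\<^sub>R (ln (Gamma t) *\<^sub>R w t))"
  proof
    fix t :: real
    consider "t = 0" | "t = 1" | "t \<noteq> 0" "t \<noteq> 1" by blast
    thus "indicator {0<..<1} t *\<^sub>R (ln (Gamma t) *\<^sub>R w t) = indicator {0..1} t *\<^sub>R (ln (Gamma t) *\<^sub>R w t)"
      by cases (auto simp: indicator_def)
  qed
  finally show ?thesis .
qed

lemma norm_weighted_ln_Gamma_le:
  fixes w :: "real \<Rightarrow> 'a :: real_normed_vector"
  assumes "\<And>t. 0 < t \<Longrightarrow> t < 1 \<Longrightarrow> norm (w t) * (1 - t) \<le> K" "K \<ge> 0" "t \<in> {0..1}"
  shows "norm (ln (Gamma t) *\<^sub>R w t) \<le> K * t powr (-1/2)"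
proof -
  consider "t = 0" | "t = 1" | "0 < t" "t < 1" using assms(3) by fastforce
  thus ?thesis
  proof cases
    case 3
    hence "norm (ln (Gamma t) *\<^sub>R w t) \<le> ((1 - t) * t powr (-1/2)) * norm (w t)"
      using ln_Gamma_bounds_unit[of t] by (simp add: mult_right_mono)
    also have "\<dots> = norm (w t) * (1 - t) * t powr (-1/2)"
      by simp
    also have "\<dots> \<le> K * t powr (-1/2)"
      using assms(1)[OF 3] by (intro mult_right_mono) auto
    finally show ?thesis .
  qed (use assms(2) in auto)
qed

lemma set_integrable_weighted_ln_Gamma:
  fixes w :: "real \<Rightarrow> 'a :: {banach, second_countable_topology}"
  assumes "continuous_on {0<..<1} w"
    and "\<And>t. 0 < t \<Longrightarrow> t < 1 \<Longrightarrow> norm (w t) * (1 - t) \<le> K" "K \<ge> 0"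
  shows "set_integrable lborel {0..1} (\<lambda>t. ln (Gamma t) *\<^sub>R w t)"
proof (rule set_integrable_bound)
  show "set_integrable lborel {0..1} (\<lambda>t. K * t powr (-1/2))"
    using set_integrable_powr_minus_half by simp
  show "set_borel_measurable lborel {0..1} (\<lambda>t. ln (Gamma t) *\<^sub>R w t)"
    unfolding set_borel_measurable_def using measurable_weighted_ln_Gamma[OF assms(1)] by simp
  show "AE t in lborel. t \<in> {0..1} \<longrightarrow> norm (ln (Gamma t) *\<^sub>R w t) \<le> norm (K * t powr (-1/2))"
  proof (intro AE_I2 impI)
    fix t :: real assume "t \<in> {0..1}"
    hence "norm (ln (Gamma t) *\<^sub>R w t) \<le> K * t powr (-1/2)"
      by (intro norm_weighted_ln_Gamma_le assms(2,3))
    thus "norm (ln (Gamma t) *\<^sub>R w t) \<le> norm (K * t powr (-1/2))"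
      by simp
  qed
qed

section \<open>Combinations of powers and logarithms\<close>

text \<open>
  $P(0)$ is the constant term of the expansion at infinity, and so the only possible limit.
\<close>

definition null_log_polynomial :: "(nat \<Rightarrow> real) \<Rightarrow> bool" where
  "null_log_polynomial f \<longleftrightarrow>
     (\<exists>P Q. poly P 0 = 0 \<and> (\<forall>n. f n = poly P (real n) + poly Q (real n) * ln (real n)))"

lemma null_log_polynomialI:
  assumes "poly P 0 = 0" "\<And>n. f n = poly P (real n) + poly Q (real n) * ln (real n)"
  shows "null_log_polynomial f"
  using assms unfolding null_log_polynomial_def by blast

lemma null_log_polynomial_add:
  assumes "null_log_polynomial f" "null_log_polynomial g"
  shows "null_log_polynomial (\<lambda>n. f n + g n)"
proof -
  obtain P Q P' Q' where "poly P 0 = 0" "\<And>n. f n = poly P (real n) + poly Q (real n) * ln (real n)"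
    "poly P' 0 = 0" "\<And>n. g n = poly P' (real n) + poly Q' (real n) * ln (real n)"
    using assms unfolding null_log_polynomial_def by metis
  thus ?thesis
    by (intro null_log_polynomialI[of "P + P'" _ "Q + Q'"]) (auto simp: algebra_simps)
qed

lemma null_log_polynomial_cmult:
  assumes "null_log_polynomial f"
  shows "null_log_polynomial (\<lambda>n. c * f n)"
proof -
  obtain P Q where "poly P 0 = 0" "\<And>n. f n = poly P (real n) + poly Q (real n) * ln (real n)"
    using assms unfolding null_log_polynomial_def by metis
  thus ?thesis
    by (intro null_log_polynomialI[of "smult c P" _ "smult c Q"]) (auto simp: algebra_simps)
qed

lemma null_log_polynomial_sum:
  assumes "\<And>i. i \<in> I \<Longrightarrow> null_log_polynomial (f i)"
  shows "null_log_polynomial (\<lambda>n. \<Sum>i\<in>I. f i n)"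
proof (cases "finite I")
  case True
  thus ?thesis using assms
  proof (induction I)
    case (insert i I)
    thus ?case by (auto intro!: null_log_polynomial_add)
  qed (auto intro!: null_log_polynomialI[of 0 _ 0])
qed (auto intro!: null_log_polynomialI[of 0 _ 0])

lemma null_log_polynomial_power_ln: "null_log_polynomial (\<lambda>n. real n ^ j * ln (real n))"
  by (rule null_log_polynomialI[of 0 _ "monom 1 j"]) (auto simp: poly_monom)

lemma null_log_polynomial_power: "j > 0 \<Longrightarrow> null_log_polynomial (\<lambda>n. real n ^ j)"
  by (rule null_log_polynomialI[of "monom 1 j" _ 0]) (auto simp: poly_monom)

text \<open>
  Sums of powers are polynomials with zero constant term, by induction on the exponent: telescope
  $(m+1)^{j+1} - m^{j+1}$ and solve for the sum of the $j$-th powers.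
\<close>

lemma null_log_polynomial_sum_power: "null_log_polynomial (\<lambda>n. \<Sum>m<n. real m ^ j)"
proof (induction j rule: less_induct)
  case (less j)
  let ?f = "\<lambda>n. 1 / (real j + 1) * (real n ^ Suc j
                  + (- 1) * (\<Sum>i<j. real (Suc j choose i) * (\<Sum>m<n. real m ^ i)))"
  have "null_log_polynomial ?f"
    using less.IH
    by (intro null_log_polynomial_cmult null_log_polynomial_add null_log_polynomial_sum
          null_log_polynomial_power) auto
  also have "?f = (\<lambda>n. \<Sum>m<n. real m ^ j)"
  proof
    fix n
    have "real n ^ Suc j = (\<Sum>m<n. real (Suc m) ^ Suc j - real m ^ Suc j)"
      by (subst sum_lessThan_telescope) simp
    also have "\<dots> = (\<Sum>m<n. \<Sum>i\<le>j. real (Suc j choose i) * real m ^ i)"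
    proof (intro sum.cong refl)
      fix m
      have "real (Suc m) ^ Suc j = (\<Sum>i\<le>Suc j. real (Suc j choose i) * real m ^ i)"
        using binomial_ring[of "real m" 1 "Suc j"] by (simp add: add.commute)
      thus "real (Suc m) ^ Suc j - real m ^ Suc j = (\<Sum>i\<le>j. real (Suc j choose i) * real m ^ i)"
        by simp
    qed
    also have "\<dots> = (\<Sum>i\<le>j. real (Suc j choose i) * (\<Sum>m<n. real m ^ i))"
      by (subst sum.swap) (simp add: sum_distrib_left)
    also have "\<dots> = (\<Sum>i<j. real (Suc j choose i) * (\<Sum>m<n. real m ^ i)) + (real j + 1) * (\<Sum>m<n. real m ^ j)"
      by (simp flip: lessThan_Suc_atMost)
    finally show "?f n = (\<Sum>m<n. real m ^ j)"
      by (simp add: field_simps)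
  qed
  finally show ?case .
qed

text \<open>
  In the summand $m = k$ the power of $n$ is constant, but there the Kronecker delta
  removes the term without logarithm.
\<close>

lemma null_log_polynomial_glaisher_p: "null_log_polynomial (\<lambda>n. glaisher_p n k)"
proof -
  let ?c = "\<lambda>m. bernoulli_num (m + 1) / (fact (m + 1) * fact (k - m))"
  let ?h = "\<lambda>m. (1 - (if k = m then 1 else 0)) * (\<Sum>l = 1..m. 1 / (real k - real l + 1))"
  have summand: "null_log_polynomial (\<lambda>n. ?c m * (real n ^ (k - m) * ln (real n) + ?h m * real n ^ (k - m)))"
    if "m \<in> {1..k}" for m
  proof (cases "m = k")
    case True
    thus ?thesis
      using null_log_polynomial_cmult[OF null_log_polynomial_power_ln[of 0], of "?c m"] by simp
  next
    case False
    thus ?thesis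
      using that by (intro null_log_polynomial_cmult null_log_polynomial_add
          null_log_polynomial_power_ln null_log_polynomial_power) auto
  qed
  have "null_log_polynomial (\<lambda>n. \<Sum>m=1..k. ?c m * (real n ^ (k - m) * ln (real n) + ?h m * real n ^ (k - m)))"
    by (intro null_log_polynomial_sum summand)
  hence "null_log_polynomial (\<lambda>n. 1 / 2 * (real n ^ k * ln (real n))
          + (1 / real (k + 1) * (real n ^ (k + 1) * ln (real n) + (- 1 / real (k + 1)) * real n ^ (k + 1))
          + fact k * (\<Sum>m=1..k. ?c m * (real n ^ (k - m) * ln (real n) + ?h m * real n ^ (k - m)))))"
    by (intro null_log_polynomial_add null_log_polynomial_cmult
          null_log_polynomial_power_ln null_log_polynomial_power) auto
  also have "(\<lambda>n. 1 / 2 * (real n ^ k * ln (real n))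
          + (1 / real (k + 1) * (real n ^ (k + 1) * ln (real n) + (- 1 / real (k + 1)) * real n ^ (k + 1))
          + fact k * (\<Sum>m=1..k. ?c m * (real n ^ (k - m) * ln (real n) + ?h m * real n ^ (k - m)))))
        = (\<lambda>n. glaisher_p n k)"
  proof
    fix n
    have "(\<Sum>m=1..k. ?c m * (real n ^ (k - m) * ln (real n) + ?h m * real n ^ (k - m)))
        = (\<Sum>m=1..k. real n ^ (k - m) * bernoulli_num (m + 1) / (fact (m + 1) * fact (k - m)) * (ln (real n) + ?h m))"
      by (intro sum.cong refl) (simp add: ring_distribs add_divide_distrib mult_ac del: fact_Suc)
    thus "1 / 2 * (real n ^ k * ln (real n))
          + (1 / real (k + 1) * (real n ^ (k + 1) * ln (real n) + (- 1 / real (k + 1)) * real n ^ (k + 1))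
          + fact k * (\<Sum>m=1..k. ?c m * (real n ^ (k - m) * ln (real n) + ?h m * real n ^ (k - m))))
        = glaisher_p n k"
      unfolding glaisher_p_def by (simp add: right_diff_distrib diff_divide_distrib mult_ac)
  qed
  finally show ?thesis .
qed

text \<open>
  The functions $n^i$ and $n^j \log n$ have pairwise different growth, so a convergent combination
  consists of its constant term only. Dividing by the presumed dominant term shows that its leading
  coefficient vanishes.
\<close>

lemma null_log_polynomial_limit:
  assumes "null_log_polynomial f" and lim: "f \<longlonglongrightarrow> L"
  shows "L = 0"
proof -
  obtain P Q where P0: "poly P 0 = 0" and f: "\<And>n. f n = poly P (real n) + poly Q (real n) * ln (real n)"
    using assms unfolding null_log_polynomial_def by metis
  define e d where "e = degree P" and "d = degree Q"
  have at_inf: "filterlim real at_infinity sequentially"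
    by (intro filterlim_at_top_imp_at_infinity filterlim_real_sequentially)
  have P: "(\<lambda>n. poly P (real n) / real n ^ e) \<longlonglongrightarrow> lead_coeff P"
    and Q: "(\<lambda>n. poly Q (real n) / real n ^ d) \<longlonglongrightarrow> lead_coeff Q"
    unfolding e_def d_def by (rule filterlim_compose[OF poly_divide_tendsto_aux at_inf])+
  have ln: "filterlim (\<lambda>n. ln (real n)) at_top sequentially"
    by (rule filterlim_compose[OF ln_at_top filterlim_real_sequentially])
  have power_ln: "filterlim (\<lambda>n. real n ^ i * ln (real n)) at_top sequentially" for i
  proof (rule filterlim_at_top_mono[OF ln])
    show "eventually (\<lambda>n. ln (real n) \<le> real n ^ i * ln (real n)) sequentially"
      using eventually_ge_at_top[of 1]
    proof eventually_elim
      case (elim n)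
      hence "1 * ln (real n) \<le> real n ^ i * ln (real n)"
        by (intro mult_right_mono) auto
      thus ?case by simp
    qed
  qed
  have "\<not> e > d"
  proof
    assume "e > d"
    have "(\<lambda>n. ln (real n) / real n powr real (e - d)) \<longlonglongrightarrow> 0"
      using \<open>e > d\<close> by (intro lim_ln_over_power) auto
    from tendsto_add[OF P tendsto_mult[OF Q this]]
    have "(\<lambda>n. poly P (real n) / real n ^ e
              + poly Q (real n) / real n ^ d * (ln (real n) / real n powr real (e - d))) \<longlonglongrightarrow> lead_coeff P"
      by simp
    moreover have "eventually (\<lambda>n. poly P (real n) / real n ^ e
              + poly Q (real n) / real n ^ d * (ln (real n) / real n powr real (e - d)) = f n / real n ^ e) sequentially"
      using eventually_gt_at_top[of 0]
    proof eventually_elim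
      case (elim n)
      have "real n ^ e = real n ^ d * real n ^ (e - d)"
        using \<open>e > d\<close> by (simp flip: power_add)
      thus ?case
        using elim by (simp add: f powr_realpow add_divide_distrib)
    qed
    ultimately have "(\<lambda>n. f n / real n ^ e) \<longlonglongrightarrow> lead_coeff P"
      by (rule Lim_transform_eventually)
    moreover have "(\<lambda>n. f n / real n ^ e) \<longlonglongrightarrow> 0"
      using \<open>e > d\<close> by (intro real_tendsto_divide_at_top[OF lim] filterlim_pow_at_top filterlim_real_sequentially) auto
    ultimately have "lead_coeff P = 0"
      by (rule LIMSEQ_unique)
    thus False
      using \<open>e > d\<close> by (simp add: e_def)
  qed
  hence ed: "e \<le> d"
    by simp
  have "(\<lambda>n. poly P (real n) / real n ^ e / (real n ^ (d - e) * ln (real n))) \<longlonglongrightarrow> 0"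
    by (rule real_tendsto_divide_at_top[OF P power_ln])
  from tendsto_add[OF this Q]
  have "(\<lambda>n. poly P (real n) / real n ^ e / (real n ^ (d - e) * ln (real n)) + poly Q (real n) / real n ^ d)
          \<longlonglongrightarrow> lead_coeff Q"
    by simp
  moreover have "eventually (\<lambda>n. poly P (real n) / real n ^ e / (real n ^ (d - e) * ln (real n))
          + poly Q (real n) / real n ^ d = f n / (real n ^ d * ln (real n))) sequentially"
    using eventually_gt_at_top[of 1]
  proof eventually_elim
    case (elim n)
    have "real n ^ d = real n ^ e * real n ^ (d - e)"
      using ed by (simp flip: power_add)
    thus ?case
      using elim by (simp add: f add_divide_distrib)
  qed
  ultimately have "(\<lambda>n. f n / (real n ^ d * ln (real n))) \<longlonglongrightarrow> lead_coeff Q"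
    by (rule Lim_transform_eventually)
  moreover have "(\<lambda>n. f n / (real n ^ d * ln (real n))) \<longlonglongrightarrow> 0"
    by (rule real_tendsto_divide_at_top[OF lim power_ln])
  ultimately have "lead_coeff Q = 0"
    by (rule LIMSEQ_unique)
  hence "Q = 0" and "e = 0"
    using ed by (auto simp: d_def)
  hence "f = (\<lambda>n. 0)"
    using P0 by (auto simp: f e_def elim!: degree_eq_zeroE)
  thus ?thesis
    using lim LIMSEQ_unique tendsto_const by blast
qed

section \<open>Moments of the logarithm of the Gamma function\<close>

lemma continuous_on_x_ln_x: "continuous_on {0..1} (\<lambda>t::real. t * ln t)"
  unfolding continuous_on_eq_continuous_within
proof
  fix t :: real assume t: "t \<in> {0..1}"
  show "continuous (at t within {0..1}) (\<lambda>t. t * ln t)"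
  proof (cases "t = 0")
    case True
    have "((\<lambda>t::real. t * ln t) \<longlongrightarrow> 0) (at_right 0)"
      by real_asymp
    thus ?thesis
      by (simp add: True continuous_within at_within_Icc_at_right)
  next
    case False
    thus ?thesis
      using t by (intro continuous_intros) auto
  qed
qed

text \<open>
  Integration by parts, with $t^{n+1} - (-m)^{n+1}$ rather than $t^{n+1}$ as antiderivative of
  $(n+1)t^n$: this is divisible by $t + m$, the denominator produced by differentiating the logarithm,
  so that a polynomial remains to be integrated. For $m = 0$ the logarithm is singular at $t = 0$, but the antiderivative still
  extends continuously.
\<close>

lemma has_integral_power_ln_shift:
  "((\<lambda>t. real (Suc n) * t ^ n * ln (t + real m)) has_integral
      (1 - (- real m) ^ Suc n) * ln (real m + 1) + (- real m) ^ Suc n * ln (real m)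
        - (\<Sum>i\<le>n. (- real m) ^ (n - i) / real (Suc i))) {0..1}"
proof -
  define c where "c = - real m"
  define G where "G t = (t ^ Suc n - c ^ Suc n) * ln (t - c) - (\<Sum>i\<le>n. c ^ (n - i) * (t ^ Suc i / real (Suc i)))" for t
  have "((\<lambda>t. real (Suc n) * t ^ n * ln (t - c)) has_integral (G 1 - G 0)) {0..1}"
  proof (rule fundamental_theorem_of_calculus_interior)
    fix t :: real assume t: "t \<in> {0<..<1}"
    have pos: "t - c > 0"
      using t by (simp add: c_def add_pos_nonneg)
    have "(G has_real_derivative (t ^ Suc n - c ^ Suc n) * (1 / (t - c)) + real (Suc n) * t ^ n * ln (t - c)
             - (\<Sum>i\<le>n. c ^ (n - i) * t ^ i)) (at t)"
      unfolding G_def[abs_def]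
    proof (intro DERIV_diff DERIV_sum)
      show "((\<lambda>t. (t ^ Suc n - c ^ Suc n) * ln (t - c)) has_real_derivative
               (t ^ Suc n - c ^ Suc n) * (1 / (t - c)) + real (Suc n) * t ^ n * ln (t - c)) (at t)"
        using pos by (auto intro!: derivative_eq_intros simp del: power_Suc)
      show "((\<lambda>t. c ^ (n - i) * (t ^ Suc i / real (Suc i))) has_real_derivative c ^ (n - i) * t ^ i) (at t)" for i
        by (auto intro!: derivative_eq_intros simp del: power_Suc of_nat_Suc)
    qed
    also have "(t ^ Suc n - c ^ Suc n) * (1 / (t - c)) = (\<Sum>i\<le>n. c ^ (n - i) * t ^ i)"
      unfolding diff_power_eq_sum lessThan_Suc_atMost using pos by (simp add: mult.commute)
    finally show "(G has_vector_derivative real (Suc n) * t ^ n * ln (t - c)) (at t)"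
      by (simp add: has_real_derivative_iff_has_vector_derivative)
  next
    have "continuous_on {0..1} (\<lambda>t. (t ^ Suc n - c ^ Suc n) * ln (t - c))"
    proof (cases "m = 0")
      case True
      have "continuous_on {0..1} (\<lambda>t::real. t ^ n * (t * ln t))"
        by (intro continuous_intros continuous_on_x_ln_x)
      thus ?thesis
        by (simp add: True c_def mult_ac)
    next
      case False
      thus ?thesis
        by (intro continuous_intros) (auto simp: c_def)
    qed
    thus "continuous_on {0..1} G"
      unfolding G_def[abs_def] by (rule continuous_on_diff) (intro continuous_intros, auto)
  qed auto
  moreover have "G 1 - G 0 = (1 - c ^ Suc n) * ln (real m + 1) + c ^ Suc n * ln (real m)
                   - (\<Sum>i\<le>n. c ^ (n - i) / real (Suc i))"
    by (simp add: G_def c_def add.commute)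
  ultimately show ?thesis
    by (simp add: c_def)
qed

text \<open>
  Summation by parts: the coefficient of $\log m$ becomes $(-m)^{n+1} - (1-m)^{n+1}$, up to the
  contribution of the sum of the $\log(m+1)$. The binomial theorem expands it into powers below $n + 1$, and this is where the
  coefficients $(-1)^k \binom{n+1}{k}$ of the final formula come from.
\<close>

lemma sum_power_ln_difference:
  "(\<Sum>m<N. (1 - (- real m) ^ Suc n) * ln (real m + 1) + (- real m) ^ Suc n * ln (real m))
     = (\<Sum>m<N. ln (real m + 1)) - (- real N) ^ Suc n * ln (real N)
       - (\<Sum>k\<le>n. (-1) ^ k * real (Suc n choose k) * (\<Sum>m=1..N. real m ^ k * ln (real m)))"
proof (induction N)
  case (Suc N)
  define x where "x = real N + 1"
  have "(1 - x) ^ Suc n = (\<Sum>k\<le>Suc n. real (Suc n choose k) * (- x) ^ k)"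
    using binomial_ring[of "- x" 1 "Suc n"] by (simp add: add.commute)
  also have "\<dots> = (\<Sum>k\<le>n. (-1) ^ k * real (Suc n choose k) * x ^ k) + (- x) ^ Suc n"
    by (simp add: power_minus[of x] mult_ac del: binomial_Suc_Suc power_Suc)
  finally have "(- real N) ^ Suc n = (\<Sum>k\<le>n. (-1) ^ k * real (Suc n choose k) * x ^ k) + (- x) ^ Suc n"
    by (simp add: x_def)
  hence *: "(- real N) ^ Suc n * ln x
          = (\<Sum>k\<le>n. (-1) ^ k * real (Suc n choose k) * (x ^ k * ln x)) + (- x) ^ Suc n * ln x"
    by (simp only: distrib_right sum_distrib_right mult.assoc)
  have sum_Suc: "(\<Sum>k\<le>n. (-1) ^ k * real (Suc n choose k) * (\<Sum>m=1..Suc N. real m ^ k * ln (real m)))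
     = (\<Sum>k\<le>n. (-1) ^ k * real (Suc n choose k) * (\<Sum>m=1..N. real m ^ k * ln (real m)))
       + (\<Sum>k\<le>n. (-1) ^ k * real (Suc n choose k) * (x ^ k * ln x))"
    by (simp add: x_def distrib_left sum.distrib add.commute del: binomial_Suc_Suc power_Suc)
  have x: "real N + 1 = x" "real (Suc N) = x"
    by (simp_all add: x_def)
  have "(1 - (- real N) ^ Suc n) * ln x = ln x - (- real N) ^ Suc n * ln x"
    by (simp only: left_diff_distrib mult_1)
  thus ?case
    unfolding sum.lessThan_Suc Suc.IH sum_Suc x using * by linarith
qed simp

text \<open>
  The moment $L$ is approximated up to $1/N$ by an explicit expression \<open>I N\<close>. This consists of the
  sums that define the constants \<open>glaisher_D k\<close> and a combination of $N^i$ ($i > 0$) and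
  $N^j \log N$.
\<close>

lemma has_integral_power_ln_Gamma:
  "((\<lambda>t. real (Suc n) * t ^ n * ln (Gamma t)) has_integral
      (\<Sum>k\<le>n. (-1) ^ k * real (Suc n choose k) * ln (glaisher_D k))) {0..1}"
proof -
  define w where "w t = real (Suc n) * t ^ n" for t :: real
  define c where "c k = (-1) ^ k * real (Suc n choose k)" for k
  define S where "S k N = (\<Sum>m=1..N. real m ^ k * ln (real m))" for k N
  define R where "R N = (\<Sum>m<N. \<Sum>i\<le>n. (- real m) ^ (n - i) / real (Suc i))" for N
  define I where "I N = (\<Sum>k\<le>n. c k * S k N) + ((- real N) ^ Suc n - 1 / (real n + 2)) * ln (real N) + R N" for N
  define L where "L = integral {0..1} (\<lambda>t. w t * ln (Gamma t))"
  have w_power: "(w has_integral 1) {0..1}" and w_t: "((\<lambda>t. w t * t) has_integral real (Suc n) / (real n + 2)) {0..1}"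
  proof -
    have *: "((\<lambda>t. real (Suc j) * t ^ j) has_integral 1) {0..1}" for j
    proof -
      have "((\<lambda>t. real (Suc j) * t ^ j) has_integral (1 ^ Suc j - 0 ^ Suc j)) {0..1}"
        by (rule fundamental_theorem_of_calculus)
          (auto intro!: derivative_eq_intros simp del: power_Suc of_nat_Suc
             simp flip: has_real_derivative_iff_has_vector_derivative)
      thus ?thesis by simp
    qed
    show "(w has_integral 1) {0..1}"
      unfolding w_def using * .
    have "((\<lambda>t. real (Suc n) / (real n + 2) * (real (Suc (Suc n)) * t ^ Suc n)) has_integral
             real (Suc n) / (real n + 2) * 1) {0..1}"
      by (intro has_integral_mult_right *)
    also have "(\<lambda>t. real (Suc n) / (real n + 2) * (real (Suc (Suc n)) * t ^ Suc n)) = (\<lambda>t. w t * t)"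
    proof -
      have Suc_Suc: "real (Suc (Suc n)) = real n + 2" by simp
      show ?thesis
        unfolding w_def Suc_Suc by (simp add: mult_ac del: of_nat_Suc)
    qed
    finally show "((\<lambda>t. w t * t) has_integral real (Suc n) / (real n + 2)) {0..1}"
      by simp
  qed
  have "set_integrable lborel {0..1} (\<lambda>t. ln (Gamma t) *\<^sub>R w t)"
  proof (rule set_integrable_weighted_ln_Gamma)
    show "continuous_on {0<..<1} w"
      unfolding w_def by (intro continuous_intros)
    fix t :: real assume t: "0 < t" "t < 1"
    have "t ^ n * (1 - t) \<le> 1 * 1"
      using t by (intro mult_mono power_le_one) auto
    thus "norm (w t) * (1 - t) \<le> real (Suc n)"
      using t by (simp add: w_def mult.assoc mult_left_le)
  qed simp
  hence "(\<lambda>t. ln (Gamma t) *\<^sub>R w t) integrable_on {0..1}"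
    by (rule set_borel_integral_eq_integral)
  hence L: "((\<lambda>t. w t * ln (Gamma t)) has_integral L) {0..1}"
    unfolding L_def by (simp add: mult.commute has_integral_integral)
  have approx: "\<bar>L - I N\<bar> \<le> 1 / real N" if N: "N \<ge> 1" for N
  proof -
    \<comment> \<open>The approximation of $\log\Gamma(t)$ obtained by linearising $\log\Gamma(t+N)$ in \<open>t\<close>.\<close>
    define h where "h t = ln (Gamma (real N)) + t * ln (real N) - (\<Sum>m<N. ln (t + real m))" for t
    have "ln (Gamma (real N)) = (\<Sum>m<N - 1. ln (1 + real m))"
      using ln_Gamma_plus_nat[of 1 "N - 1"] N by (simp add: of_nat_diff)
    also have "\<dots> = (\<Sum>m<N. ln (real m + 1)) - ln (real N)"
      using N by (cases N) (auto simp: add.commute)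
    finally have Gamma_N: "ln (Gamma (real N)) = (\<Sum>m<N. ln (real m + 1)) - ln (real N)" .
    have "((\<lambda>t. w t * ln (Gamma (real N)) + w t * t * ln (real N) - (\<Sum>m<N. w t * ln (t + real m))) has_integral
             1 * ln (Gamma (real N)) + real (Suc n) / (real n + 2) * ln (real N)
               - (\<Sum>m<N. (1 - (- real m) ^ Suc n) * ln (real m + 1) + (- real m) ^ Suc n * ln (real m)
                     - (\<Sum>i\<le>n. (- real m) ^ (n - i) / real (Suc i)))) {0..1}"
      unfolding w_def
      by (intro has_integral_diff has_integral_add has_integral_sum has_integral_power_ln_shift
            has_integral_mult_left w_power[unfolded w_def] w_t[unfolded w_def]) auto
    also have "1 * ln (Gamma (real N)) + real (Suc n) / (real n + 2) * ln (real N)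
               - (\<Sum>m<N. (1 - (- real m) ^ Suc n) * ln (real m + 1) + (- real m) ^ Suc n * ln (real m)
                     - (\<Sum>i\<le>n. (- real m) ^ (n - i) / real (Suc i))) = I N"
    proof -
      have weight: "real (Suc n) / (real n + 2) = 1 - 1 / (real n + 2)"
        by (simp add: field_simps)
      show ?thesis
        unfolding weight sum_subtractf[of _ "\<lambda>m. \<Sum>i\<le>n. _ m i"] sum_power_ln_difference Gamma_N I_def R_def S_def c_def
        by (simp add: algebra_simps del: binomial_Suc_Suc power_Suc)
    qed
    also have "(\<lambda>t. w t * ln (Gamma (real N)) + w t * t * ln (real N) - (\<Sum>m<N. w t * ln (t + real m))) = (\<lambda>t. w t * h t)"
      by (simp add: h_def algebra_simps sum_distrib_left)
    finally have I: "((\<lambda>t. w t * h t) has_integral I N) {0..1}" .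
    have close: "h t - 1 / real N \<le> ln (Gamma t) \<and> ln (Gamma t) \<le> h t" if t: "t \<in> {0<..<1}" for t
      using ln_Gamma_plus_nat[of t N] ln_Gamma_add_le[of "real N" t] ln_Gamma_add_ge[of "real N" t] t N
      by (simp add: h_def add.commute)
    have nonneg: "0 \<le> w t" if "t \<in> {0<..<1}" for t
      using that by (simp add: w_def)
    have "L \<le> I N"
    proof (rule has_integral_le)
      show "((\<lambda>t. w t * ln (Gamma t)) has_integral L) {0<..<1}" "((\<lambda>t. w t * h t) has_integral I N) {0<..<1}"
        using L I by (simp_all add: has_integral_Icc_iff_Ioo)
    qed (use close nonneg in \<open>auto intro: mult_left_mono\<close>)
    moreover have "I N - 1 * (1 / real N) \<le> L"
    proof (rule has_integral_le)
      have "((\<lambda>t. w t * h t - w t * (1 / real N)) has_integral I N - 1 * (1 / real N)) {0..1}"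
        by (intro has_integral_diff has_integral_mult_left I w_power)
      thus "((\<lambda>t. w t * (h t - 1 / real N)) has_integral I N - 1 * (1 / real N)) {0<..<1}"
        unfolding has_integral_Icc_iff_Ioo right_diff_distrib .
      show "((\<lambda>t. w t * ln (Gamma t)) has_integral L) {0<..<1}"
        using L by (simp_all add: has_integral_Icc_iff_Ioo)
    qed (use close nonneg in \<open>auto intro: mult_left_mono\<close>)
    ultimately show ?thesis
      by simp
  qed
  have "(\<lambda>N. L - I N) \<longlonglongrightarrow> 0"
  proof (rule Lim_null_comparison)
    show "eventually (\<lambda>N. norm (L - I N) \<le> 1 / real N) sequentially"
      by (intro eventually_sequentiallyI[of 1]) (simp add: approx)
  qed (rule lim_1_over_n)
  hence "I \<longlonglongrightarrow> L"
    using tendsto_diff[OF tendsto_const[of L]] by fastforce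
  moreover have "(\<lambda>N. \<Sum>k\<le>n. c k * (S k N - glaisher_p N k)) \<longlonglongrightarrow> (\<Sum>k\<le>n. c k * ln (glaisher_D k))"
    unfolding S_def by (intro tendsto_sum tendsto_mult tendsto_const glaisher_limit)
  ultimately have "(\<lambda>N. I N - (\<Sum>k\<le>n. c k * (S k N - glaisher_p N k))) \<longlonglongrightarrow> L - (\<Sum>k\<le>n. c k * ln (glaisher_D k))"
    by (rule tendsto_diff)
  moreover have "null_log_polynomial (\<lambda>N. I N - (\<Sum>k\<le>n. c k * (S k N - glaisher_p N k)))"
  proof -
    have "null_log_polynomial (\<lambda>N. (\<Sum>k\<le>n. c k * glaisher_p N k)
             + ((-1) ^ Suc n * (real N ^ Suc n * ln (real N)) + (- 1 / (real n + 2)) * (real N ^ 0 * ln (real N)))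
             + (\<Sum>i\<le>n. (-1) ^ (n - i) / real (Suc i) * (\<Sum>m<N. real m ^ (n - i))))"
      by (intro null_log_polynomial_add null_log_polynomial_sum null_log_polynomial_cmult
            null_log_polynomial_glaisher_p null_log_polynomial_power_ln null_log_polynomial_sum_power)
    also have "(\<lambda>N. (\<Sum>k\<le>n. c k * glaisher_p N k)
             + ((-1) ^ Suc n * (real N ^ Suc n * ln (real N)) + (- 1 / (real n + 2)) * (real N ^ 0 * ln (real N)))
             + (\<Sum>i\<le>n. (-1) ^ (n - i) / real (Suc i) * (\<Sum>m<N. real m ^ (n - i))))
          = (\<lambda>N. I N - (\<Sum>k\<le>n. c k * (S k N - glaisher_p N k)))"
    proof
      fix N
      have "R N = (\<Sum>i\<le>n. (-1) ^ (n - i) / real (Suc i) * (\<Sum>m<N. real m ^ (n - i)))"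
        unfolding R_def by (subst sum.swap) (simp add: sum_distrib_left power_minus[of "real _"])
      moreover have "(- real N) ^ Suc n = (-1) ^ Suc n * real N ^ Suc n"
        by (rule power_minus)
      ultimately show "(\<Sum>k\<le>n. c k * glaisher_p N k)
             + ((-1) ^ Suc n * (real N ^ Suc n * ln (real N)) + (- 1 / (real n + 2)) * (real N ^ 0 * ln (real N)))
             + (\<Sum>i\<le>n. (-1) ^ (n - i) / real (Suc i) * (\<Sum>m<N. real m ^ (n - i)))
          = I N - (\<Sum>k\<le>n. c k * (S k N - glaisher_p N k))"
        unfolding I_def right_diff_distrib sum_subtractf by (simp add: algebra_simps del: power_Suc)
    qed
    finally show ?thesis .
  qed
  ultimately have "L - (\<Sum>k\<le>n. c k * ln (glaisher_D k)) = 0"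
    using null_log_polynomial_limit by blast
  thus ?thesis
    using L by (simp add: w_def c_def)
qed

section \<open>The fractional integral\<close>

text \<open>
  The asymptotics of the binomial coefficients give $\binom{\alpha-1}{n} = O(n^{-\Re\alpha})$.
\<close>

lemma gbinomial_bounded:
  fixes \<alpha> :: complex
  assumes "Re \<alpha> > 0"
  obtains K where "K > 0" "\<And>n. norm ((\<alpha> - 1) gchoose n) \<le> K"
proof -
  have "convergent (\<lambda>n. ((\<alpha> - 1) gchoose n) / ((-1) ^ n / exp (\<alpha> * of_real (ln (real n)))))"
    using gbinomial_asymptotic[of "\<alpha> - 1"] by (auto simp: convergent_def)
  then obtain B where B: "\<And>n. norm (((\<alpha> - 1) gchoose n) / ((-1) ^ n / exp (\<alpha> * of_real (ln (real n))))) \<le> B"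
    using BseqE[OF convergent_imp_Bseq] by blast
  have "norm ((\<alpha> - 1) gchoose n) \<le> max B 1" for n
  proof (cases "n = 0")
    case False
    have "norm ((\<alpha> - 1) gchoose n) * 1 \<le> norm ((\<alpha> - 1) gchoose n) * exp (Re \<alpha> * ln (real n))"
      using False assms by (intro mult_left_mono) auto
    also have "\<dots> = norm (((\<alpha> - 1) gchoose n) / ((-1) ^ n / exp (\<alpha> * of_real (ln (real n)))))"
      by (simp add: norm_mult norm_divide norm_power)
    finally show ?thesis
      using B[of n] by simp
  qed simp
  thus ?thesis
    by (intro that[of "max B 1"]) auto
qed

theorem theorem1:
  fixes \<alpha> :: complex
  assumes "Re \<alpha> > 0"
  shows "set_integrable lborel {0..1}
           (\<lambda>t. complex_of_real (1 - t) powr (\<alpha> - 1) * complex_of_real (ln (Gamma t)))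
       \<and> summable (\<lambda>n. glaisher_term \<alpha> (Suc n))
       \<and> RL_integral \<alpha> 0 (\<lambda>t. complex_of_real (ln (Gamma t))) 1
           = 1 / Gamma (\<alpha> + 1) * (\<Sum>n. glaisher_term \<alpha> (Suc n))"
proof -
  define w where "w t = complex_of_real (1 - t) powr (\<alpha> - 1)" for t
  define b where "b n = ((\<alpha> - 1) gchoose n)" for n
  define p where "p N t = (\<Sum>n<N. b n * (- complex_of_real t) ^ n)" for N t
  obtain K where K: "K > 0" "\<And>n. norm (b n) \<le> K"
    using gbinomial_bounded[OF assms] unfolding b_def by blast
  have alpha: "\<alpha> \<noteq> 0"
    using assms by auto
  have cont_w: "continuous_on {0<..<1} w"
    unfolding w_def by (intro continuous_intros) (auto simp: complex_nonpos_Reals_iff)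
  have cont_p: "continuous_on {0<..<1} (p N)" for N
    unfolding p_def by (intro continuous_intros)
  have norm_w: "norm (w t) * (1 - t) \<le> 1" if "0 < t" "t < 1" for t
  proof -
    have "norm (w t) = (1 - t) powr (Re \<alpha> - 1)"
      using that unfolding w_def by (subst norm_powr_real_powr) auto
    hence "norm (w t) * (1 - t) = (1 - t) powr Re \<alpha>"
      using that by (simp add: powr_diff)
    also have "\<dots> \<le> 1"
      using that assms by (intro powr_le1) auto
    finally show ?thesis .
  qed
  have norm_p: "norm (p N t) * (1 - t) \<le> K" if "0 < t" "t < 1" for N t
  proof -
    have "norm (p N t) \<le> (\<Sum>n<N. K * t ^ n)"
      unfolding p_def using that K
      by (intro sum_norm_le) (auto simp: norm_mult norm_power intro!: mult_right_mono)
    also have "\<dots> = K * ((1 - t ^ N) / (1 - t))"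
      using that by (simp add: sum_gp_strict flip: sum_distrib_left)
    finally have "norm (p N t) * (1 - t) \<le> K * ((1 - t ^ N) / (1 - t)) * (1 - t)"
      using that by (intro mult_right_mono) auto
    also have "\<dots> = K * (1 - t ^ N)"
      using that by simp
    also have "\<dots> \<le> K * 1"
      using that K by (intro mult_left_mono) auto
    finally show ?thesis by simp
  qed
  have int_w: "set_integrable lborel {0..1} (\<lambda>t. ln (Gamma t) *\<^sub>R w t)"
    using cont_w norm_w by (rule set_integrable_weighted_ln_Gamma) auto
  \<comment> \<open>The partial sums of the binomial series are at most $K \sum_n t^n = K/(1-t)$ in norm.\<close>
  have lim: "(\<lambda>N. LINT t:{0..1}|lborel. ln (Gamma t) *\<^sub>R p N t)
               \<longlonglongrightarrow> (LINT t:{0..1}|lborel. ln (Gamma t) *\<^sub>R w t)"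
    unfolding set_lebesgue_integral_def
  proof (rule integral_dominated_convergence)
    show "integrable lborel (\<lambda>t. indicator {0..1} t *\<^sub>R (K * t powr (-1/2)))"
      using set_integrable_powr_minus_half unfolding set_integrable_def[symmetric] by simp
    show "AE t in lborel. norm (indicator {0..1} t *\<^sub>R (ln (Gamma t) *\<^sub>R p N t))
            \<le> indicator {0..1} t *\<^sub>R (K * t powr (-1/2))" for N
      using norm_weighted_ln_Gamma_le[of "p N" K] norm_p K(1) by (intro AE_I2) (auto simp: indicator_def)
    show "AE t in lborel. (\<lambda>N. indicator {0..1} t *\<^sub>R (ln (Gamma t) *\<^sub>R p N t))
            \<longlonglongrightarrow> indicator {0..1} t *\<^sub>R (ln (Gamma t) *\<^sub>R w t)"
    proof (intro AE_I2)
      fix t :: real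
      show "(\<lambda>N. indicator {0..1} t *\<^sub>R (ln (Gamma t) *\<^sub>R p N t))
              \<longlonglongrightarrow> indicator {0..1} t *\<^sub>R (ln (Gamma t) *\<^sub>R w t)"
      proof (cases "t \<in> {0..<1}")
        case True
        hence "(\<lambda>n. b n * (- complex_of_real t) ^ n) sums (1 + - complex_of_real t) powr (\<alpha> - 1)"
          unfolding b_def by (intro gen_binomial_complex) auto
        hence "(\<lambda>N. p N t) \<longlonglongrightarrow> w t"
          by (simp add: sums_def p_def w_def)
        thus ?thesis
          by (intro tendsto_scaleR tendsto_const)
      next
        case False
        hence "indicator {0..1} t *\<^sub>R (ln (Gamma t) *\<^sub>R x) = 0" for x :: complex
          by (cases "t = 1") (auto simp: indicator_def)
        thus ?thesis by (simp only: tendsto_const)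
      qed
    qed
  qed (use measurable_weighted_ln_Gamma[OF cont_w] measurable_weighted_ln_Gamma[OF cont_p] in auto)
  have moment: "(LINT t:{0..1}|lborel. ln (Gamma t) *\<^sub>R (b n * (- complex_of_real t) ^ n))
                  = glaisher_term \<alpha> (Suc n) / \<alpha>"
    and int_moment: "set_integrable lborel {0..1} (\<lambda>t. ln (Gamma t) *\<^sub>R (b n * (- complex_of_real t) ^ n))" for n
  proof -
    let ?M = "\<Sum>k\<le>n. (-1) ^ k * real (Suc n choose k) * ln (glaisher_D k)"
    have int: "set_integrable lborel {0..1} (\<lambda>t. ln (Gamma t) *\<^sub>R t ^ n)"
    proof (rule set_integrable_weighted_ln_Gamma)
      show "norm (t ^ n) * (1 - t) \<le> 1" if "0 < t" "t < 1" for t :: real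
        using that by (auto intro!: mult_le_one power_le_one)
    qed (auto intro!: continuous_intros)
    have "((\<lambda>t. ln (Gamma t) * t ^ n) has_integral ?M / real (Suc n)) {0..1}"
      using has_integral_divide[OF has_integral_power_ln_Gamma[of n], of "real (Suc n)"]
      by (simp add: mult_ac del: of_nat_Suc)
    hence M: "(LINT t:{0..1}|lborel. ln (Gamma t) *\<^sub>R t ^ n) = ?M / real (Suc n)"
      using set_borel_integral_eq_integral(2)[OF int] by (simp add: integral_unique)
    have eq: "ln (Gamma t) *\<^sub>R (b n * (- complex_of_real t) ^ n)
                = (b n * (-1) ^ n) * complex_of_real (ln (Gamma t) *\<^sub>R t ^ n)" for t
      by (simp add: scaleR_conv_of_real power_minus[of "complex_of_real t"])
    show "set_integrable lborel {0..1} (\<lambda>t. ln (Gamma t) *\<^sub>R (b n * (- complex_of_real t) ^ n))"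
      unfolding eq using integrable_of_real[OF int[unfolded set_integrable_def]]
      by (intro set_integrable_mult_right) (simp add: set_integrable_def scaleR_conv_of_real)
    have "(LINT t:{0..1}|lborel. ln (Gamma t) *\<^sub>R (b n * (- complex_of_real t) ^ n))
            = b n * (-1) ^ n * complex_of_real (?M / real (Suc n))"
      unfolding eq set_integral_mult_right set_integral_complex_of_real M ..
    also have "\<dots> = (-1) ^ n * (b n / of_nat (Suc n)) * complex_of_real ?M"
      by simp
    also have "b n / of_nat (Suc n) = (\<alpha> gchoose Suc n) / \<alpha>"
      using gbinomial_absorption[of n \<alpha>] alpha unfolding b_def
      by (simp add: field_simps del: of_nat_Suc)
    finally show "(LINT t:{0..1}|lborel. ln (Gamma t) *\<^sub>R (b n * (- complex_of_real t) ^ n))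
                  = glaisher_term \<alpha> (Suc n) / \<alpha>"
      by (simp add: glaisher_term_def atLeast0LessThan lessThan_Suc_atMost del: binomial_Suc_Suc)
  qed
  have "(LINT t:{0..1}|lborel. ln (Gamma t) *\<^sub>R p N t) = (\<Sum>n<N. glaisher_term \<alpha> (Suc n) / \<alpha>)" for N
    using int_moment moment unfolding p_def set_integrable_def set_lebesgue_integral_def scaleR_sum_right
    by (subst Bochner_Integration.integral_sum) auto
  hence "(\<lambda>n. glaisher_term \<alpha> (Suc n) / \<alpha>) sums (LINT t:{0..1}|lborel. ln (Gamma t) *\<^sub>R w t)"
    using lim by (simp add: sums_def)
  from sums_mult[OF this, of \<alpha>]
  have sums: "(\<lambda>n. glaisher_term \<alpha> (Suc n)) sums (\<alpha> * (LINT t:{0..1}|lborel. ln (Gamma t) *\<^sub>R w t))"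
    using alpha by simp
  have w: "ln (Gamma t) *\<^sub>R w t = complex_of_real (1 - t) powr (\<alpha> - 1) * complex_of_real (ln (Gamma t))" for t
    by (simp add: w_def scaleR_conv_of_real)
  have "\<alpha> \<notin> \<int>\<^sub>\<le>\<^sub>0"
    using assms by (auto elim!: nonpos_Ints_cases)
  hence "Gamma (\<alpha> + 1) = \<alpha> * Gamma \<alpha>"
    by (rule Gamma_plus1)
  hence "RL_integral \<alpha> 0 (\<lambda>t. complex_of_real (ln (Gamma t))) 1
           = 1 / Gamma (\<alpha> + 1) * (\<Sum>n. glaisher_term \<alpha> (Suc n))"
    using alpha by (simp add: RL_integral_def sums_unique[OF sums, symmetric] w)
  thus ?thesis
    using int_w sums unfolding w sums_iff by blast
qed

end
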